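(* Let $T$ be a tree with $\ell\ge 2$ leaves in which each heavy vertex has at least one light neighbor. Let $S\subseteq V(T)$ be the set of all heavy vertices of $T$ having exactly one light neighbor. Then $$P(T)=\ell-h+s-t-1,$$ where $h$ is the number of heavy edges of $T$, $s=|S|$, and $t$ is the size of a maximum matching of the subgraph of $T$ induced by $S$.
   Context: Graphs are finite and simple. A path covering of a graph $G$ is a set of vertex-disjoint paths of $G$ (a single vertex counts as a path) containing all the vertices of $G$; the path covering number $P(G)$ is the minimum number of paths in a path covering of $G$. A leaf is a vertex of degree $1$. A vertex is heavy if its degree is greater than $2$, and light otherwise. A heavy edge is an edge both of whose endpoints are heavy vertices. The size of a matching is its number of edges. *)

theory Defs
  imports "Graph_Theory.Graph_Theory"
begin

text \<open>
  A finite simple graph is a \<^locale>\<open>graph\<close>, i.e. a finite symmetric digraph without loops and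
  parallel arcs; the edge between \<open>u\<close> and \<open>v\<close> is there represented by the two arcs \<open>(u,v)\<close>
  and \<open>(v,u)\<close>. Undirected edges are recovered as two-element vertex sets.
\<close>

definition edges :: "('a,'b) pre_digraph \<Rightarrow> 'a set set" where
  "edges G = {{u, v} | u v. u \<rightarrow>\<^bsub>G\<^esub> v}"

text \<open>
  The library predicate \<^const>\<open>tree\<close> is unusable for symmetric digraphs: going along an edge
  and back is a \<^const>\<open>pre_digraph.cycle\<close> of length 2, so only edgeless graphs would be
  acyclic. The cycles of length at least 3 are exactly the cycles of the undirected graph.
\<close>

definition undirected_tree :: "('a,'b) pre_digraph \<Rightarrow> bool" where
  "undirected_tree G \<longleftrightarrow>
     graph G \<and> Digraph_Component.connected G \<and> \<not> (\<exists>p. pre_digraph.cycle G p \<and> 3 \<le> length p)"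

text \<open>In a \<^locale>\<open>graph\<close>, each edge at \<open>v\<close> contributes exactly one arc leaving \<open>v\<close>.\<close>

definition degree :: "('a,'b) pre_digraph \<Rightarrow> 'a \<Rightarrow> nat" where
  "degree G v = out_degree G v"

definition leaves :: "('a,'b) pre_digraph \<Rightarrow> 'a set" where
  "leaves G = {v \<in> verts G. degree G v = 1}"

definition heavy :: "('a,'b) pre_digraph \<Rightarrow> 'a \<Rightarrow> bool" where
  "heavy G v \<longleftrightarrow> v \<in> verts G \<and> degree G v > 2"

definition light :: "('a,'b) pre_digraph \<Rightarrow> 'a \<Rightarrow> bool" where
  "light G v \<longleftrightarrow> v \<in> verts G \<and> degree G v \<le> 2"

definition light_neighbors :: "('a,'b) pre_digraph \<Rightarrow> 'a \<Rightarrow> 'a set" where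
  "light_neighbors G v = {u. v \<rightarrow>\<^bsub>G\<^esub> u \<and> light G u}"

definition heavy_edges :: "('a,'b) pre_digraph \<Rightarrow> 'a set set" where
  "heavy_edges G = {e \<in> edges G. \<forall>v\<in>e. heavy G v}"

definition matching :: "('a,'b) pre_digraph \<Rightarrow> 'a set set \<Rightarrow> bool" where
  "matching G M \<longleftrightarrow> M \<subseteq> edges G \<and> (\<forall>e\<in>M. \<forall>f\<in>M. e \<noteq> f \<longrightarrow> e \<inter> f = {})"

definition maximum_matching_size :: "('a,'b) pre_digraph \<Rightarrow> nat" where
  "maximum_matching_size G = Max (card ` {M. matching G M})"

text \<open>
  A path is given by its vertex sequence (\<^const>\<open>vpath\<close>: a nonempty list of distinct vertices,
  consecutive ones adjacent). A sequence and its reversal describe the same path; as paths are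
  nonempty, disjointness ensures that a covering contains at most one of the two.
\<close>

definition path_covering :: "('a,'b) pre_digraph \<Rightarrow> 'a list set \<Rightarrow> bool" where
  "path_covering G C \<longleftrightarrow>
     finite C \<and> (\<forall>p\<in>C. vpath p G) \<and>
     (\<forall>p\<in>C. \<forall>q\<in>C. p \<noteq> q \<longrightarrow> set p \<inter> set q = {}) \<and>
     (\<Union>p\<in>C. set p) = verts G"

definition path_covering_number :: "('a,'b) pre_digraph \<Rightarrow> nat" where
  "path_covering_number G = (LEAST k. \<exists>C. path_covering G C \<and> card C = k)"

end

theory Submission
  imports Defs
begin

text \<open>
  In a forest, a set of edges in which every vertex has degree at most two is the edge set of a
  unique path covering, with as many paths as vertices minus edges. So \<open>P(T) - 1\<close> is the least
  size of an edge set \<open>R\<close> that contains at least \<open>deg v - 2\<close> edges at each heavy vertex \<open>v\<close>; and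
  \<open>deg v - 2\<close> sums up to \<open>\<ell> - 2\<close> over the heavy vertices. Removing a heavy edge serves two
  vertices, so ideally all heavy edges are in \<open>R\<close>, saving \<open>h\<close>. But then \<open>R\<close> has one edge too many
  at each vertex of \<open>S\<close>: each such vertex costs one unless a heavy edge at it is kept, and a kept
  edge repairs two of them only if it lies within \<open>S\<close>. The loss is therefore at least \<open>s - t\<close>, and
  it is attained by keeping precisely a maximum matching of \<open>S\<close>.
\<close>

section \<open>Edges of vertex sequences\<close>

text \<open>Forgetting the orientation of the arcs makes the edge set invariant under reversal of
  the sequence and lets it be compared with \<open>edges G\<close>.\<close>

definition vedges :: "'a list \<Rightarrow> 'a set set" where
  "vedges p = (\<lambda>(u, v). {u, v}) ` set (vwalk_arcs p)"

definition edeg :: "'a set set \<Rightarrow> 'a \<Rightarrow> nat" where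
  "edeg F v = card {e \<in> F. v \<in> e}"

text \<open>A cycle is encoded as an open path together with the edge closing it. The bound 3
  excludes a single edge traversed back and forth. Being a property of the edge set alone, it passes
  to subsets.\<close>

definition edge_acyclic :: "'a set set \<Rightarrow> bool" where
  "edge_acyclic F \<longleftrightarrow>
     \<not> (\<exists>p. distinct p \<and> 3 \<le> length p \<and> vedges p \<subseteq> F \<and> {last p, hd p} \<in> F)"

lemma vedges_simps [simp]:
  "vedges [] = {}" "vedges [x] = {}" "vedges (x # y # p) = insert {x, y} (vedges (y # p))"
  by (auto simp: vedges_def)

lemma vedges_append:
  "p \<noteq> [] \<Longrightarrow> q \<noteq> [] \<Longrightarrow> vedges (p @ q) = insert {last p, hd q} (vedges p \<union> vedges q)"
  by (auto simp: vedges_def vwalk_arcs_append)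

lemma vedges_rev [simp]: "vedges (rev p) = vedges p"
proof (induction p rule: vwalk_arcs.induct)
  case (3 x y p)
  have "vedges (rev (x # y # p)) = vedges (rev (y # p) @ [x])" by simp
  also have "\<dots> = insert {last (rev (y # p)), hd [x]} (vedges (rev (y # p)) \<union> vedges [x])"
    by (rule vedges_append) auto
  finally show ?case using 3 by (simp add: insert_commute)
qed auto

lemma vedges_subset: "e \<in> vedges p \<Longrightarrow> e \<subseteq> set p"
  by (induction p rule: vwalk_arcs.induct) auto

lemma vedges_nonempty: "e \<in> vedges p \<Longrightarrow> e \<noteq> {}"
  by (auto simp: vedges_def)

lemma finite_vedges [simp]: "finite (vedges p)"
  by (simp add: vedges_def)

lemma card_vedges: "distinct p \<Longrightarrow> card (vedges p) = length p - 1"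
proof (induction p rule: vwalk_arcs.induct)
  case (3 x y p)
  then have "{x, y} \<notin> vedges (y # p)" using vedges_subset by fastforce
  then show ?case using 3 by simp
qed auto

text \<open>Supplies the length condition of \<open>edge_acyclic\<close>: different ends need at
  least two vertices, and with exactly two the closing edge would already be the only edge of the
  path.\<close>

lemma three_le_length:
  assumes "p \<noteq> []" "hd p \<noteq> last p" "{last p, hd p} \<notin> vedges p"
  shows "3 \<le> length p"
proof -
  obtain x q where p: "p = x # q" using assms(1) by (cases p) auto
  then obtain y r where q: "q = y # r" using assms(2) by (cases q) auto
  then have "r \<noteq> []" using assms(3) p by (auto simp: insert_commute)
  then show ?thesis using p q by (cases r) auto
qed

lemma edeg_eq_0: "(\<And>e. e \<in> F \<Longrightarrow> v \<notin> e) \<Longrightarrow> edeg F v = 0"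
  unfolding edeg_def by (metis (no_types, lifting) card.empty empty_Collect_eq)

lemma edeg_mono: "finite G \<Longrightarrow> F \<subseteq> G \<Longrightarrow> edeg F v \<le> edeg G v"
  unfolding edeg_def by (rule card_mono) auto

text \<open>Splitting the path at \<open>v\<close> leaves only the edges to its predecessor and to
  its successor. If one of these is missing, \<open>last xs\<close> or \<open>hd ys\<close> is an
  arbitrary value, which is harmless for an upper bound.\<close>

lemma edeg_vedges_le_2:
  assumes "distinct p" shows "edeg (vedges p) v \<le> 2"
proof (cases "v \<in> set p")
  case True
  then obtain xs ys where p: "p = xs @ v # ys" by (auto simp: in_set_conv_decomp)
  have ys: "vedges (v # ys) \<subseteq> insert {v, hd ys} (vedges ys)" by (cases ys) auto
  have "vedges p \<subseteq> insert {last xs, v} (vedges xs \<union> vedges (v # ys))"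
    unfolding p by (cases "xs = []") (auto simp: vedges_append)
  moreover have "v \<notin> set xs" "v \<notin> set ys" using assms p by auto
  then have "v \<notin> e" if "e \<in> vedges xs \<union> vedges ys" for e
    using that vedges_subset by blast
  ultimately have "{e \<in> vedges p. v \<in> e} \<subseteq> {{last xs, v}, {v, hd ys}}"
    using ys by blast
  then have "edeg (vedges p) v \<le> card {{last xs, v}, {v, hd ys}}"
    unfolding edeg_def by (rule card_mono[rotated]) auto
  also have "\<dots> \<le> 2" by (simp add: card_insert_if)
  finally show ?thesis .
next
  case False
  then have "edeg (vedges p) v = 0" by (intro edeg_eq_0) (auto dest: vedges_subset)
  then show ?thesis by simp
qed

text \<open>An inner vertex has a predecessor and a successor, which differ because the path is
  distinct; so it lies on two edges.\<close>

lemma end_of_path_if_edeg_le_1: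
  assumes "distinct p" "v \<in> set p" "edeg (vedges p) v \<le> 1"
  shows "v = hd p \<or> v = last p"
proof (rule ccontr)
  assume *: "\<not> ?thesis"
  obtain xs ys where p: "p = xs @ v # ys" using assms(2) by (auto simp: in_set_conv_decomp)
  with * have ne: "xs \<noteq> []" "ys \<noteq> []" by (auto split: if_splits)
  then have "vedges p = insert {last xs, v} (vedges xs \<union> insert {v, hd ys} (vedges ys))"
    unfolding p by (cases ys) (auto simp: vedges_append)
  then have sub: "{{last xs, v}, {v, hd ys}} \<subseteq> {e \<in> vedges p. v \<in> e}" by auto
  have "last xs \<noteq> hd ys" "last xs \<noteq> v"
    using assms(1) ne unfolding p by (auto dest: last_in_set hd_in_set)
  then have "{last xs, v} \<noteq> {v, hd ys}" by (auto simp: doubleton_eq_iff)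
  then have "2 = card {{last xs, v}, {v, hd ys}}" by simp
  also have "\<dots> \<le> edeg (vedges p) v"
    unfolding edeg_def by (rule card_mono[OF _ sub]) simp
  finally show False using assms(3) by simp
qed

text \<open>Loop erasure: whenever the walk returns to a vertex already on the path, the path is cut
  back to that vertex.\<close>

lemma distinct_path_of_rtrancl:
  assumes "(u, v) \<in> {(x, y). {x, y} \<in> F}\<^sup>*"
  shows "\<exists>p. p \<noteq> [] \<and> distinct p \<and> hd p = u \<and> last p = v \<and> vedges p \<subseteq> F"
  using assms
proof (induction rule: rtrancl_induct)
  case base
  show ?case by (intro exI[of _ "[u]"]) auto
next
  case (step y z)
  then obtain p where p: "p \<noteq> []" "distinct p" "hd p = u" "last p = y" "vedges p \<subseteq> F" by blast
  show ?case
  proof (cases "z \<in> set p")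
    case True
    then obtain xs ys where xs: "p = (xs @ [z]) @ ys" by (auto simp: in_set_conv_decomp)
    have "vedges (xs @ [z]) \<subseteq> vedges p"
      unfolding xs by (cases "ys = []") (auto simp: vedges_append simp del: append_assoc)
    then show ?thesis using p xs by (intro exI[of _ "xs @ [z]"]) (auto simp: hd_append)
  next
    case False
    then show ?thesis using p step.hyps by (intro exI[of _ "p @ [z]"]) (auto simp: vedges_append)
  qed
qed

section \<open>Path coverings and edge sets of maximum degree two\<close>

text \<open>Each path has one vertex more than it has edges, and disjoint paths share no edges, so
  summing over \<open>C\<close> gives the count. All edges at \<open>v\<close> belong to the one
  path through \<open>v\<close>, which bounds the degree.\<close>

lemma edge_set_of_disjoint_paths:
  assumes "finite C" and paths: "\<And>p. p \<in> C \<Longrightarrow> p \<noteq> [] \<and> distinct p"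
    and disj: "\<And>p q. p \<in> C \<Longrightarrow> q \<in> C \<Longrightarrow> p \<noteq> q \<Longrightarrow> set p \<inter> set q = {}"
  shows "card (\<Union>p\<in>C. vedges p) + card C = card (\<Union>p\<in>C. set p)"
    and "edeg (\<Union>p\<in>C. vedges p) v \<le> 2"
proof -
  have "card (\<Union>p\<in>C. vedges p) = (\<Sum>p\<in>C. card (vedges p))"
  proof (rule card_UN_disjoint)
    show "\<forall>p\<in>C. \<forall>q\<in>C. p \<noteq> q \<longrightarrow> vedges p \<inter> vedges q = {}"
    proof (intro ballI impI equals0I)
      fix p q e assume "p \<in> C" "q \<in> C" "p \<noteq> q" and e: "e \<in> vedges p \<inter> vedges q"
      then have "set p \<inter> set q = {}" using disj by blast
      then show False using e vedges_subset[of e p] vedges_subset[of e q] vedges_nonempty[of e p]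
        by blast
    qed
  qed (use assms in auto)
  moreover have "card (\<Union>p\<in>C. set p) = (\<Sum>p\<in>C. card (set p))"
    by (rule card_UN_disjoint) (use assms in auto)
  moreover have "(\<Sum>p\<in>C. card (vedges p)) + card C = (\<Sum>p\<in>C. card (vedges p) + 1)"
    by (simp only: sum.distrib card_eq_sum)
  moreover have "(\<Sum>p\<in>C. card (vedges p) + 1) = (\<Sum>p\<in>C. card (set p))"
  proof (rule sum.cong[OF refl])
    fix p assume "p \<in> C"
    then have "p \<noteq> []" "distinct p" using paths by auto
    then show "card (vedges p) + 1 = card (set p)"
      by (cases p) (auto simp: card_vedges distinct_card)
  qed
  ultimately show "card (\<Union>p\<in>C. vedges p) + card C = card (\<Union>p\<in>C. set p)" by simp
  show "edeg (\<Union>p\<in>C. vedges p) v \<le> 2"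
  proof (cases "\<exists>p\<in>C. v \<in> set p")
    case True
    then obtain p where p: "p \<in> C" "v \<in> set p" by blast
    have "{e \<in> \<Union>p\<in>C. vedges p. v \<in> e} = {e \<in> vedges p. v \<in> e}"
      using p disj by (fastforce dest: vedges_subset)
    then show ?thesis using edeg_vedges_le_2[of p v] paths p by (simp add: edeg_def)
  next
    case False
    then have "edeg (\<Union>p\<in>C. vedges p) v = 0" by (intro edeg_eq_0) (auto dest: vedges_subset)
    then show ?thesis by simp
  qed
qed

lemma edge_acyclic_subset: "edge_acyclic F \<Longrightarrow> G \<subseteq> F \<Longrightarrow> edge_acyclic G"
  unfolding edge_acyclic_def by blast

lemma edeg_insert:
  "finite F \<Longrightarrow> e \<notin> F \<Longrightarrow> v \<in> e \<Longrightarrow> edeg (insert e F) v = edeg F v + 1"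
proof -
  assume a: "finite F" "e \<notin> F" "v \<in> e"
  then have "{f \<in> insert e F. v \<in> f} = insert e {f \<in> F. v \<in> f}" by auto
  then show ?thesis using a by (simp add: edeg_def)
qed

text \<open>Converse of the previous correspondence, by adding edges one at a time to the covering
  by single vertices. The degree bound places both ends of the new edge at ends of paths, and
  acyclicity makes these paths different; so two paths merge into one.\<close>

lemma disjoint_paths_of_edge_set:
  assumes "finite F" "finite V" "\<And>e. e \<in> F \<Longrightarrow> card e = 2 \<and> e \<subseteq> V"
    "\<And>v. edeg F v \<le> 2" "edge_acyclic F"
  shows "\<exists>C. finite C \<and> (\<forall>p\<in>C. p \<noteq> [] \<and> distinct p) \<and>
    (\<forall>p\<in>C. \<forall>q\<in>C. p \<noteq> q \<longrightarrow> set p \<inter> set q = {}) \<and>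
    (\<Union>p\<in>C. set p) = V \<and> (\<Union>p\<in>C. vedges p) = F \<and> card C + card F = card V"
  using assms
proof (induction F rule: finite_induct)
  case empty
  show ?case
    using empty
    by (intro exI[of _ "(\<lambda>v. [v]) ` V"]) (auto simp: card_image inj_on_def)
next
  case (insert e F)
  have le: "edeg F v \<le> edeg (insert e F) v" for v
    using insert.hyps by (intro edeg_mono) auto
  have Fle: "edeg F v \<le> 2" for v
    using le insert.prems(3) by (rule order_trans)
  have Fac: "edge_acyclic F" using insert.prems(4) by (rule edge_acyclic_subset) auto
  obtain C where C0: "finite C" "\<forall>p\<in>C. p \<noteq> [] \<and> distinct p"
    "\<forall>p\<in>C. \<forall>q\<in>C. p \<noteq> q \<longrightarrow> set p \<inter> set q = {}"
    and C456: "(\<Union>p\<in>C. set p) = V" "(\<Union>p\<in>C. vedges p) = F" "card C + card F = card V"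
    using insert.IH[OF insert.prems(1) insert.prems(2)[OF insertI2] Fle Fac] by auto
  have C: "finite C" "\<And>p. p \<in> C \<Longrightarrow> p \<noteq> [] \<and> distinct p"
    "\<And>p q. p \<in> C \<Longrightarrow> q \<in> C \<Longrightarrow> p \<noteq> q \<Longrightarrow> set p \<inter> set q = {}"
    "(\<Union>p\<in>C. set p) = V" "(\<Union>p\<in>C. vedges p) = F" "card C + card F = card V"
    using C0 C456 by metis+
  have "card e = 2" "e \<subseteq> V" using insert.prems(2)[OF insertI1] by simp_all
  then obtain u v where e: "e = {u, v}" "u \<noteq> v" by (meson card_2_iff)
  have "u \<in> V" "v \<in> V" using \<open>e \<subseteq> V\<close> e(1) by simp_all
  then obtain p q where p: "p \<in> C" "u \<in> set p" and q: "q \<in> C" "v \<in> set q" using C(4) by blast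
  \<comment> \<open>With \<open>e\<close> added the degree of an endpoint of \<open>e\<close> is at
    most two, so before that it is at most one.\<close>
  have ends: "w = hd r \<or> w = last r" if "r \<in> C" "w \<in> set r" "w \<in> e" for r w
  proof (rule end_of_path_if_edeg_le_1)
    have "edeg (vedges r) w \<le> edeg F w"
      using that(1) C(5) insert.hyps by (intro edeg_mono) auto
    also have "\<dots> \<le> 1"
      using edeg_insert[OF insert.hyps that(3)] insert.prems(3)[of w] by simp
    finally show "edeg (vedges r) w \<le> 1" .
  qed (use that C in auto)
  have pne: "p \<noteq> []" "distinct p" "q \<noteq> []" "distinct q" using C(2) p(1) q(1) by auto
  \<comment> \<open>Otherwise \<open>e\<close> would join the two ends of one path and close a
    cycle.\<close>
  have "p \<noteq> q"
  proof
    assume "p = q"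
    then have hl: "{last p, hd p} = e" using ends[OF p] ends[OF q] e by auto
    then have "hd p \<noteq> last p" using e by (auto simp: doubleton_eq_iff)
    moreover have "e \<notin> vedges p" using p(1) C(5) insert.hyps by auto
    ultimately have "3 \<le> length p" using pne hl by (intro three_le_length) simp_all
    moreover have "vedges p \<subseteq> insert e F" using p(1) C(5) by auto
    ultimately show False using insert.prems(4) hl pne unfolding edge_acyclic_def by blast
  qed
  \<comment> \<open>Both paths are oriented so that the first ends in \<open>u\<close> and the
    second starts in \<open>v\<close>; their concatenation then uses exactly the edge
    \<open>e\<close> in between.\<close>
  define p' where "p' = (if u = last p then p else rev p)"
  define q' where "q' = (if v = hd q then q else rev q)"
  have p': "last p' = u" "set p' = set p" "vedges p' = vedges p" "distinct p'" "p' \<noteq> []"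
    using ends[OF p] pne e by (auto simp: p'_def last_rev)
  have q': "hd q' = v" "set q' = set q" "vedges q' = vedges q" "distinct q'" "q' \<noteq> []"
    using ends[OF q] pne e by (auto simp: q'_def hd_rev)
  define C' where "C' = C - {p, q}"
  have CC: "C = insert p (insert q C')" using p q by (auto simp: C'_def)
  have pq: "set p \<inter> set q = {}" using C(3) p(1) q(1) \<open>p \<noteq> q\<close> by blast
  have C'disj: "set r \<inter> set (p' @ q') = {}" if "r \<in> C'" for r
    using that C(3)[of r p] C(3)[of r q] p(1) q(1) p' q' by (auto simp: C'_def)
  have notin: "p' @ q' \<notin> C'" using C'disj p'(5) by fastforce
  have "card C = card C' + 2" unfolding CC
    using \<open>p \<noteq> q\<close> C(1) by (simp add: C'_def)
  then have "card (insert (p' @ q') C') + card (insert e F) = card V"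
    using C(1,6) notin insert.hyps by (simp add: C'_def)
  moreover have "vedges (p' @ q') = insert e (vedges p \<union> vedges q)"
    using p' q' e by (simp add: vedges_append)
  then have "(\<Union>r\<in>insert (p' @ q') C'. vedges r) = insert e F"
    using C(5) unfolding CC by auto
  moreover have "(\<Union>r\<in>insert (p' @ q') C'. set r) = V"
    using C(4) p' q' unfolding CC by auto
  moreover have "\<forall>r\<in>insert (p' @ q') C'. r \<noteq> [] \<and> distinct r"
    using C(2) p' q' pq by (auto simp: C'_def)
  moreover have "\<forall>r\<in>insert (p' @ q') C'. \<forall>r'\<in>insert (p' @ q') C'. r \<noteq> r' \<longrightarrow> set r \<inter> set r' = {}"
    using C'disj C(3) unfolding C'_def by (metis DiffD1 Int_commute insertE)
  moreover have "finite (insert (p' @ q') C')" using C(1) by (simp add: C'_def)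
  ultimately show ?case by (intro exI[of _ "insert (p' @ q') C'"]) simp
qed

section \<open>Counting edges\<close>

text \<open>The blocks of \<open>P\<close> are the connected components of the forest. An added edge
  joins two different blocks, since a path in \<open>F\<close> between its ends would close to a
  cycle; thus each edge lowers the number of blocks by one, starting from singletons.\<close>

lemma acyclic_component_partition:
  assumes "finite F" "finite V" "\<And>e. e \<in> F \<Longrightarrow> card e = 2 \<and> e \<subseteq> V" "edge_acyclic F"
  shows "\<exists>P. finite P \<and> {} \<notin> P \<and> \<Union>P = V \<and> (\<forall>A\<in>P. \<forall>B\<in>P. A \<noteq> B \<longrightarrow> A \<inter> B = {}) \<and>
    (\<forall>A\<in>P. A \<times> A \<subseteq> {(x, y). {x, y} \<in> F}\<^sup>*) \<and> (\<forall>e\<in>F. \<exists>A\<in>P. e \<subseteq> A) \<and>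
    card P + card F = card V"
  using assms
proof (induction F rule: finite_induct)
  case empty
  show ?case
    using empty
    by (intro exI[of _ "(\<lambda>v. {v}) ` V"]) (auto simp: card_image inj_on_def)
next
  case (insert e F)
  let ?R = "{(x, y). {x, y} \<in> F}\<^sup>*" and ?R' = "{(x, y). {x, y} \<in> insert e F}\<^sup>*"
  have Fac: "edge_acyclic F" using insert.prems(3) by (rule edge_acyclic_subset) auto
  obtain P where P0: "finite P" "{} \<notin> P" "\<Union>P = V"
    "\<forall>A\<in>P. \<forall>B\<in>P. A \<noteq> B \<longrightarrow> A \<inter> B = {}" "\<forall>A\<in>P. A \<times> A \<subseteq> ?R"
    "\<forall>e\<in>F. \<exists>A\<in>P. e \<subseteq> A" "card P + card F = card V"
    using insert.IH[OF insert.prems(1) insert.prems(2)[OF insertI2] Fac] by auto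
  have P: "finite P" "{} \<notin> P" "\<Union>P = V"
    "\<And>A B. A \<in> P \<Longrightarrow> B \<in> P \<Longrightarrow> A \<noteq> B \<Longrightarrow> A \<inter> B = {}"
    "\<And>A. A \<in> P \<Longrightarrow> A \<times> A \<subseteq> ?R" "\<And>e. e \<in> F \<Longrightarrow> \<exists>A\<in>P. e \<subseteq> A"
    "card P + card F = card V"
    using P0 by simp_all
  have "card e = 2" "e \<subseteq> V" using insert.prems(2)[OF insertI1] by simp_all
  then obtain u v where e: "e = {u, v}" "u \<noteq> v" by (meson card_2_iff)
  have "u \<in> V" "v \<in> V" using \<open>e \<subseteq> V\<close> e(1) by simp_all
  then obtain A B where A: "A \<in> P" "u \<in> A" and B: "B \<in> P" "v \<in> B" using P(3) by blast
  have "A \<noteq> B"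
  proof
    assume "A = B"
    then have "(u, v) \<in> ?R" using P(5) A B by blast
    then obtain p where p: "p \<noteq> []" "distinct p" "hd p = u" "last p = v" "vedges p \<subseteq> F"
      using distinct_path_of_rtrancl by metis
    moreover have "{last p, hd p} = e" using p e by (simp add: insert_commute)
    ultimately have "3 \<le> length p" using e insert.hyps by (intro three_le_length) auto
    moreover have "{last p, hd p} \<in> insert e F" "vedges p \<subseteq> insert e F"
      using p e by (auto simp: insert_commute)
    ultimately show False using insert.prems(3) p(2) unfolding edge_acyclic_def by blast
  qed
  define P' where "P' = P - {A, B}"
  have PP: "P = insert A (insert B P')" using A B by (auto simp: P'_def)
  have disj: "D \<inter> (A \<union> B) = {}" if "D \<in> P'" for D
    using that P(4)[of D A] P(4)[of D B] A B by (auto simp: P'_def)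
  have notin: "A \<union> B \<notin> P'" using disj A(2) by fastforce
  have "card P = card P' + 2" unfolding PP using \<open>A \<noteq> B\<close> P(1) by (simp add: P'_def)
  then have "card (insert (A \<union> B) P') + card (insert e F) = card V"
    using P(1,7) notin insert.hyps by (simp add: P'_def)
  moreover have sub: "?R \<subseteq> ?R'" by (rule rtrancl_mono) auto
  have uv: "(u, v) \<in> ?R'" "(v, u) \<in> ?R'" using e by (auto simp: insert_commute)
  have AB: "A \<times> A \<subseteq> ?R'" "B \<times> B \<subseteq> ?R'" using P(5) A B sub by blast+
  have "(A \<union> B) \<times> (A \<union> B) \<subseteq> ?R'"
  proof clarify
    have to_u: "(x, u) \<in> ?R' \<and> (u, x) \<in> ?R'" if "x \<in> A \<union> B" for x
    proof (cases "x \<in> A")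
      case True
      then show ?thesis using A AB by blast
    next
      case False
      then have "(x, v) \<in> ?R'" "(v, x) \<in> ?R'" using that B AB by blast+
      then show ?thesis using uv by (blast intro: rtrancl_trans)
    qed
    fix x y assume "x \<in> A \<union> B" "y \<in> A \<union> B"
    then show "(x, y) \<in> ?R'" using to_u by (blast intro: rtrancl_trans)
  qed
  then have "\<forall>D\<in>insert (A \<union> B) P'. D \<times> D \<subseteq> ?R'"
    using P(5) sub by (auto simp: P'_def)
  moreover have "\<forall>f\<in>insert e F. \<exists>D\<in>insert (A \<union> B) P'. f \<subseteq> D"
  proof
    fix f assume "f \<in> insert e F"
    then consider "f = e" | D where "D \<in> P" "f \<subseteq> D" using P(6) by blast
    then show "\<exists>D\<in>insert (A \<union> B) P'. f \<subseteq> D"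
      by cases (use e A B in \<open>auto simp: PP\<close>)
  qed
  moreover have "\<Union>(insert (A \<union> B) P') = V" using P(3) unfolding PP by auto
  moreover have "\<forall>D\<in>insert (A \<union> B) P'. \<forall>D'\<in>insert (A \<union> B) P'. D \<noteq> D' \<longrightarrow> D \<inter> D' = {}"
    using disj P(4) unfolding P'_def by (metis DiffD1 Int_commute insertE)
  moreover have "finite (insert (A \<union> B) P')" "{} \<notin> insert (A \<union> B) P'"
    using P(1,2) A by (auto simp: P'_def)
  ultimately show ?case by (intro exI[of _ "insert (A \<union> B) P'"]) simp
qed

text \<open>No edge leaves a block of the partition, so the block of any vertex \<open>x\<close>
  contains everything reachable from \<open>x\<close>. Connectedness leaves only one block.\<close>

lemma card_edges_of_connected_acyclic:
  assumes "finite F" "finite V" "V \<noteq> {}" "\<And>e. e \<in> F \<Longrightarrow> card e = 2 \<and> e \<subseteq> V" "edge_acyclic F"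
    and conn: "V \<times> V \<subseteq> {(x, y). {x, y} \<in> F}\<^sup>*"
  shows "card F + 1 = card V"
proof -
  obtain P where P: "{} \<notin> P" "\<Union>P = V" "\<forall>A\<in>P. \<forall>B\<in>P. A \<noteq> B \<longrightarrow> A \<inter> B = {}"
    "\<forall>e\<in>F. \<exists>A\<in>P. e \<subseteq> A" "card P + card F = card V"
    using acyclic_component_partition[OF assms(1,2,4,5)] by auto
  obtain x where "x \<in> V" using assms(3) by blast
  then obtain A where A: "A \<in> P" "x \<in> A" using P(2) by blast
  have closed: "y \<in> A" if "(x, y) \<in> {(x, y). {x, y} \<in> F}\<^sup>*" for y
    using that
  proof (induction rule: rtrancl_induct)
    case (step y z)
    then obtain B where "B \<in> P" "{y, z} \<subseteq> B" using P(4) by blast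
    then show ?case using step.IH P(3) A by blast
  qed (use A in simp)
  have "V \<subseteq> A" using closed conn \<open>x \<in> V\<close> by blast
  have "B = A" if "B \<in> P" for B
  proof (rule ccontr)
    assume "B \<noteq> A"
    then have "B \<inter> A = {}" using P(3) A that by blast
    moreover have "B \<subseteq> A" using that P(2) \<open>V \<subseteq> A\<close> by blast
    ultimately show False using that P(1) by (metis Int_absorb2)
  qed
  then have "P = {A}" using A by blast
  then show ?thesis using P(5) by simp
qed

section \<open>Degree sums by double counting of incidences\<close>

lemma sum_edeg:
  assumes "finite F" "finite W"
  shows "(\<Sum>v\<in>W. edeg F v) = (\<Sum>e\<in>F. card (e \<inter> W))"
proof -
  have "(\<Sum>v\<in>W. edeg F v) = (\<Sum>v\<in>W. \<Sum>e\<in>F. if v \<in> e then 1 else 0)"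
    unfolding edeg_def using assms by (simp add: sum.If_cases Int_def)
  also have "\<dots> = (\<Sum>e\<in>F. \<Sum>v\<in>W. if v \<in> e then 1 else 0)" by (rule sum.swap)
  also have "\<dots> = (\<Sum>e\<in>F. card (e \<inter> W))"
    using assms by (simp add: sum.If_cases Int_commute)
  finally show ?thesis .
qed

lemma sum_edeg_of_edges_within:
  assumes "finite F" "finite W" "\<And>e. e \<in> F \<Longrightarrow> card e = 2 \<and> e \<subseteq> W"
  shows "(\<Sum>v\<in>W. edeg F v) = 2 * card F"
proof -
  have "(\<Sum>e\<in>F. card (e \<inter> W)) = (\<Sum>e\<in>F. 2)"
    using assms(3) by (intro sum.cong) (auto simp: Int_absorb2)
  then show ?thesis using sum_edeg[OF assms(1,2)] by simp
qed

lemma edeg_Diff: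
  assumes "finite F" "G \<subseteq> F" shows "edeg (F - G) v + edeg G v = edeg F v"
proof -
  have "{e \<in> F. v \<in> e} = {e \<in> F - G. v \<in> e} \<union> {e \<in> G. v \<in> e}" using assms by auto
  moreover have "card ({e \<in> F - G. v \<in> e} \<union> {e \<in> G. v \<in> e}) =
      card {e \<in> F - G. v \<in> e} + card {e \<in> G. v \<in> e}"
    using assms by (intro card_Un_disjoint) (auto intro: finite_subset)
  ultimately show ?thesis by (simp add: edeg_def)
qed

text \<open>Choose for each vertex an edge covering it; the edges chosen by both of their
  endpoints form a matching.\<close>

lemma card_le_cover_plus_matching:
  assumes "finite Z" "finite K" and card2: "\<And>e. e \<in> K \<Longrightarrow> card e = 2"
    and cover: "\<And>v. v \<in> Z \<Longrightarrow> \<exists>e\<in>K. v \<in> e"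
    and match: "\<And>M. M \<subseteq> K \<Longrightarrow> \<forall>e\<in>M. e \<subseteq> Z \<Longrightarrow>
      \<forall>e\<in>M. \<forall>f\<in>M. e \<noteq> f \<longrightarrow> e \<inter> f = {} \<Longrightarrow> card M \<le> t"
  shows "card Z \<le> card K + t"
proof -
  obtain f where f: "\<And>v. v \<in> Z \<Longrightarrow> f v \<in> K \<and> v \<in> f v" using cover by metis
  let ?fib = "\<lambda>e. {v \<in> Z. f v = e}"
  \<comment> \<open>The fibre of an edge under \<open>f\<close> consists of endpoints of that edge,
    so it has at most two elements, and two precisely for the edges in \<open>M\<close>.\<close>
  define M where "M = {e \<in> K. ?fib e = e}"
  have "card Z = card (\<Union>e\<in>K. ?fib e)" using f by (intro arg_cong[where f = card]) auto
  also have "\<dots> \<le> (\<Sum>e\<in>K. card (?fib e))" using assms(2) by (rule card_UN_le)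
  also have "\<dots> \<le> (\<Sum>e\<in>K. 1 + (if e \<in> M then 1 else 0))"
  proof (rule sum_mono)
    fix e assume e: "e \<in> K"
    have fin: "finite e" using card2[OF e] card.infinite by fastforce
    have sub: "?fib e \<subseteq> e" using f by auto
    show "card (?fib e) \<le> 1 + (if e \<in> M then 1 else 0)"
    proof (cases "?fib e = e")
      case True
      then show ?thesis using e card2[OF e] by (auto simp: M_def)
    next
      case False
      then have "card (?fib e) < card e" using sub fin by (intro psubset_card_mono) auto
      then show ?thesis using card2[OF e] by simp
    qed
  qed
  also have "\<dots> = card K + card M"
    
    using assms(2) by (simp only: sum.distrib) (simp add: sum.If_cases M_def Int_def)
  also have "card M \<le> t"
    \<comment> \<open>Two edges of \<open>M\<close> cannot share a vertex \<open>v\<close>, because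
      both would equal \<open>f v\<close>.\<close>
    by (rule match) (auto simp: M_def)
  finally show ?thesis by simp
qed

section \<open>Removing edges until all degrees are at most two\<close>

text \<open>The data entering the count: \<open>W\<close> stands for the heavy vertices and
  \<open>H\<close> for the heavy edges. Light neighbors appear only as edges at a vertex outside
  \<open>H\<close>: exactly one at a vertex of \<open>S\<close>, at least two elsewhere in
  \<open>W\<close>. The last two assumptions together make \<open>t\<close> the maximum size of a
  matching within \<open>S\<close>.\<close>

locale heavy_edge_structure =
  fixes E :: "'a set set" and W :: "'a set" and H :: "'a set set" and S :: "'a set" and t :: nat
  assumes finite_E: "finite E" and finite_W: "finite W"
    and card_E: "\<And>e. e \<in> E \<Longrightarrow> card e = 2"
    and deg_W: "\<And>v. v \<in> W \<Longrightarrow> 2 < edeg E v"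
    and H_def: "H = {e \<in> E. e \<subseteq> W}"
    and S_sub: "S \<subseteq> W"
    and deg_S: "\<And>v. v \<in> S \<Longrightarrow> edeg H v + 1 = edeg E v"
    and deg_not_S: "\<And>v. v \<in> W - S \<Longrightarrow> edeg H v + 2 \<le> edeg E v"
    and matching_le: "\<And>M. M \<subseteq> E \<Longrightarrow> \<forall>e\<in>M. e \<subseteq> S \<Longrightarrow>
      \<forall>e\<in>M. \<forall>f\<in>M. e \<noteq> f \<longrightarrow> e \<inter> f = {} \<Longrightarrow> card M \<le> t"
    and matching_ex: "\<exists>M\<subseteq>E. (\<forall>e\<in>M. e \<subseteq> S) \<and> (\<forall>e\<in>M. \<forall>f\<in>M. e \<noteq> f \<longrightarrow> e \<inter> f = {}) \<and> card M = t"
begin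

lemma finite_H: "finite H" and finite_S: "finite S"
  using finite_E H_def S_sub finite_W by (auto intro: finite_subset)

text \<open>Three estimates are added: \<open>H - R\<close> covers \<open>Z\<close>, so
  \<open>card Z\<close> is at most \<open>card (H - R) + t\<close>; the degrees in \<open>R\<close>
  exceed the required total by at least \<open>card (S - Z)\<close>; and their sum over
  \<open>W\<close> is at most \<open>card R + card (R \<inter> H)\<close>.\<close>

lemma removed_edges_lower_bound:
  assumes R: "R \<subseteq> E" and deg_R: "\<And>v. v \<in> W \<Longrightarrow> edeg E v \<le> edeg R v + 2"
  shows "(\<Sum>v\<in>W. edeg E v - 2) + card S \<le> card R + card H + t"
proof -
  have fR: "finite R" using R finite_E finite_subset by blast
  \<comment> \<open>\<open>Z\<close> collects the vertices of \<open>S\<close> at which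
    \<open>R\<close> has no surplus. There \<open>H\<close> has one edge more than \<open>R\<close>,
    so some heavy edge is kept.\<close>
  define Z where "Z = {v \<in> S. edeg R v + 2 = edeg E v}"
  have "card Z \<le> card (H - R) + t"
  proof (rule card_le_cover_plus_matching)
    show "finite Z" using finite_S by (simp add: Z_def)
    fix v assume v: "v \<in> Z"
    show "\<exists>e\<in>H - R. v \<in> e"
    proof (rule ccontr)
      assume "\<not> ?thesis"
      then have "edeg H v \<le> edeg R v"
        unfolding edeg_def using fR by (intro card_mono) auto
      then show False using v deg_S[of v] by (simp add: Z_def)
    qed
  next
    fix M assume M: "M \<subseteq> H - R" "\<forall>e\<in>M. e \<subseteq> Z" "\<forall>e\<in>M. \<forall>f\<in>M. e \<noteq> f \<longrightarrow> e \<inter> f = {}"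
    show "card M \<le> t"
    proof (rule matching_le[OF _ _ M(3)])
      show "M \<subseteq> E" using M(1) by (auto simp: H_def)
      show "\<forall>e\<in>M. e \<subseteq> S" using M(2) by (auto simp: Z_def)
    qed
  qed (use finite_H card_E in \<open>auto simp: H_def\<close>)
  moreover have "(\<Sum>v\<in>W. edeg E v - 2) + card (S - Z) \<le> (\<Sum>v\<in>W. edeg R v)"
  proof -
    have "card (S - Z) = (\<Sum>v\<in>W. if v \<in> S - Z then 1 else 0)"
      using finite_W S_sub by (simp add: sum.If_cases Int_absorb1 Int_def)
        (rule arg_cong[where f = card], auto)
    then have "(\<Sum>v\<in>W. edeg E v - 2) + card (S - Z) =
        (\<Sum>v\<in>W. (edeg E v - 2) + (if v \<in> S - Z then 1 else 0))"
      by (simp only: sum.distrib)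
    \<comment> \<open>A vertex of \<open>S\<close> outside \<open>Z\<close> has at least one edge of
      \<open>R\<close> beyond the required \<open>edeg E v - 2\<close>.\<close>
    also have "\<dots> \<le> (\<Sum>v\<in>W. edeg R v)"
    proof (rule sum_mono)
      fix v assume v: "v \<in> W"
      then show "(edeg E v - 2) + (if v \<in> S - Z then 1 else 0) \<le> edeg R v"
        using deg_R[OF v] deg_W[OF v] by (auto simp: Z_def)
    qed
    finally show ?thesis .
  qed
  moreover have "(\<Sum>v\<in>W. edeg R v) \<le> card R + card (R \<inter> H)"
  proof -
    have "(\<Sum>v\<in>W. edeg R v) = (\<Sum>e\<in>R. card (e \<inter> W))" using sum_edeg fR finite_W by blast
    \<comment> \<open>A removed edge serves two vertices of \<open>W\<close> if it is heavy and at
      most one otherwise.\<close>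
    also have "\<dots> \<le> (\<Sum>e\<in>R. 1 + (if e \<in> H then 1 else 0))"
    proof (rule sum_mono)
      fix e assume e: "e \<in> R"
      then have c: "card e = 2" "e \<in> E" using card_E R by auto
      then have fin: "finite e" using card.infinite by fastforce
      show "card (e \<inter> W) \<le> 1 + (if e \<in> H then 1 else 0)"
      proof (cases "e \<subseteq> W")
        case True
        then show ?thesis using c by (simp add: H_def Int_absorb2)
      next
        case False
        then have "card (e \<inter> W) < card e" using fin by (intro psubset_card_mono) auto
        then show ?thesis using c by simp
      qed
    qed
    also have "\<dots> = card R + card (R \<inter> H)" 
      using fR by (simp only: sum.distrib) (simp add: sum.If_cases)
    finally show ?thesis .
  qed
  moreover have "card H = card (R \<inter> H) + card (H - R)"
    using finite_H by (metis Int_commute card_Int_Diff)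
  moreover have "card S = card Z + card (S - Z)"
    using finite_S by (subst card_Int_Diff[of S Z]) (auto simp: Z_def Int_def intro!: arg_cong[where f = card])
  ultimately show ?thesis by linarith
qed

text \<open>All heavy edges are removed except a maximum matching \<open>M\<close> of
  \<open>S\<close>. At a vertex of \<open>S\<close> this keeps at most one heavy edge and the single
  non-heavy one. Vertices of \<open>W - S\<close> are missed by \<open>M\<close>, and the removals
  still owed there are taken from non-heavy edges.\<close>

lemma removed_edges_upper_bound:
  obtains R where "R \<subseteq> E" "\<And>v. v \<in> W \<Longrightarrow> edeg E v \<le> edeg R v + 2"
    "card R + card H + t \<le> (\<Sum>v\<in>W. edeg E v - 2) + card S"
proof -
  obtain M where M: "M \<subseteq> E" "\<forall>e\<in>M. e \<subseteq> S" "card M = t"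
    and M_disj: "\<forall>e\<in>M. \<forall>f\<in>M. e \<noteq> f \<longrightarrow> e \<inter> f = {}" using matching_ex by blast
  have MH: "M \<subseteq> H" using M S_sub by (auto simp: H_def)
  have fM: "finite M" using MH finite_H finite_subset by blast
  \<comment> \<open>Truncated subtraction makes the choice possible at every \<open>v\<close>; only
    the sets at vertices of \<open>W - S\<close> are put into \<open>R\<close>.\<close>
  have "\<exists>X. X \<subseteq> {e \<in> E - H. v \<in> e} \<and> card X = edeg E v - 2 - edeg H v" for v
  proof -
    have "edeg (E - H) v + edeg H v = edeg E v"
      using finite_E by (intro edeg_Diff) (auto simp: H_def)
    then have "edeg E v - 2 - edeg H v \<le> card {e \<in> E - H. v \<in> e}" by (simp add: edeg_def)
    then show ?thesis by (meson obtain_subset_with_card_n)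
  qed
  then obtain X where X: "\<And>v. X v \<subseteq> {e \<in> E - H. v \<in> e}"
    "\<And>v. card (X v) = edeg E v - 2 - edeg H v" by metis
  define R where "R = (H - M) \<union> (\<Union>v\<in>W - S. X v)"
  have RE: "R \<subseteq> E" using X(1) by (auto simp: R_def H_def)
  have fR: "finite R" using RE finite_E finite_subset by blast
  have deg_HM: "edeg (H - M) v + edeg M v = edeg H v" for v
    using finite_H MH by (rule edeg_Diff)
  have "edeg E v \<le> edeg R v + 2" if v: "v \<in> W" for v
  proof (cases "v \<in> S")
    case True
    have "edeg M v \<le> 1"
    proof (rule ccontr)
      assume "\<not> ?thesis"
      then have "\<not> card {e \<in> M. v \<in> e} \<le> Suc 0" by (simp add: edeg_def)
      then obtain e f where "e \<in> M" "f \<in> M" "v \<in> e" "v \<in> f" "e \<noteq> f"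
        using card_le_Suc0_iff_eq[of "{e \<in> M. v \<in> e}"] fM by auto
      then show False using M_disj by blast
    qed
    moreover have "edeg (H - M) v \<le> edeg R v" using fR by (intro edeg_mono) (auto simp: R_def)
    ultimately show ?thesis using deg_HM[of v] deg_S[OF True] by linarith
  next
    case False
    then have "edeg M v = 0" using M(2) by (intro edeg_eq_0) auto
    then have 1: "card {e \<in> H - M. v \<in> e} = edeg H v" using deg_HM[of v] by (simp add: edeg_def)
    have "finite (X v)" using X(1)[of v] finite_E by (auto intro: finite_subset)
    then have "card ({e \<in> H - M. v \<in> e} \<union> X v) = card {e \<in> H - M. v \<in> e} + card (X v)"
      using X(1)[of v] finite_H by (intro card_Un_disjoint) auto
    moreover have "{e \<in> H - M. v \<in> e} \<union> X v \<subseteq> {e \<in> R. v \<in> e}"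
      using X(1)[of v] v False by (auto simp: R_def)
    then have "card ({e \<in> H - M. v \<in> e} \<union> X v) \<le> edeg R v"
      unfolding edeg_def using fR by (intro card_mono) auto
    ultimately show ?thesis using 1 X(2)[of v] by linarith
  qed
  moreover have "card R + card H + t \<le> (\<Sum>v\<in>W. edeg E v - 2) + card S"
  proof -
    have "card R \<le> card (H - M) + card (\<Union>v\<in>W - S. X v)" unfolding R_def by (rule card_Un_le)
    also have "card (\<Union>v\<in>W - S. X v) \<le> (\<Sum>v\<in>W - S. card (X v))"
      using finite_W by (intro card_UN_le) auto
    finally have 1: "card R + t \<le> card H + (\<Sum>v\<in>W - S. edeg E v - 2 - edeg H v)"
      unfolding X(2) using card_Diff_subset[OF fM MH] card_mono[OF finite_H MH] M(3) by linarith
    \<comment> \<open>On \<open>S\<close> the added 1 turns \<open>edeg E v - 2\<close> into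
      \<open>edeg H v\<close>; on \<open>W - S\<close> the same quantity is \<open>edeg H v\<close>
      plus the size of \<open>X v\<close>. The heavy degrees sum to twice the number of heavy edges,
      one copy of which pays for \<open>card H\<close> on the left-hand side of the claim.\<close>
    have "(\<Sum>v\<in>W. edeg E v - 2) + card S = (\<Sum>v\<in>W. (edeg E v - 2) + (if v \<in> S then 1 else 0))"
      using finite_W S_sub by (simp add: sum.distrib sum.If_cases Int_absorb1)
    also have "\<dots> = (\<Sum>v\<in>W. edeg H v + (if v \<in> S then 0 else edeg E v - 2 - edeg H v))"
    proof (rule sum.cong[OF refl])
      fix v assume v: "v \<in> W"
      show "(edeg E v - 2) + (if v \<in> S then 1 else 0) =
          edeg H v + (if v \<in> S then 0 else edeg E v - 2 - edeg H v)"
        using deg_S[of v] deg_not_S[of v] deg_W[OF v] v by auto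
    qed
    also have "\<dots> = 2 * card H + (\<Sum>v\<in>W - S. edeg E v - 2 - edeg H v)"
    proof -
      have "(\<Sum>v\<in>W. edeg H v) = 2 * card H"
        using card_E finite_H finite_W by (intro sum_edeg_of_edges_within) (auto simp: H_def)
      moreover have "W \<inter> - S = W - S" by auto
      ultimately show ?thesis using finite_W by (simp add: sum.distrib sum.If_cases)
    qed
    finally show ?thesis using 1 by linarith
  qed
  ultimately show thesis using RE that by blast
qed

end

section \<open>Trees\<close>

context graph
begin

lemma mem_edges_iff: "{u, v} \<in> edges G \<longleftrightarrow> u \<rightarrow>\<^bsub>G\<^esub> v"
  using arcs_ends_symmetric[OF sym_arcs] by (auto simp: edges_def doubleton_eq_iff)

lemma edges_card_2:
  assumes "e \<in> edges G" shows "card e = 2 \<and> e \<subseteq> verts G"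
proof -
  obtain u v where e: "e = {u, v}" "u \<rightarrow>\<^bsub>G\<^esub> v" using assms by (auto simp: edges_def)
  then have "u \<noteq> v" using adj_not_same by blast
  then show ?thesis using e adj_in_verts[OF e(2)] by simp
qed

lemma finite_edges: "finite (edges G)"
proof (rule finite_subset)
  show "edges G \<subseteq> Pow (verts G)" using edges_card_2 by blast
qed simp

lemma edges_at_eq: "{e \<in> edges G. v \<in> e} = (\<lambda>u. {v, u}) ` {u. v \<rightarrow>\<^bsub>G\<^esub> u}"
  using arcs_ends_symmetric[OF sym_arcs] by (auto simp: edges_def insert_commute)

text \<open>Without parallel arcs an arc leaving \<open>v\<close> is determined by its head, so the
  out-degree counts neighbors and hence incident edges.\<close>

lemma degree_eq_edeg: "degree G v = edeg (edges G) v"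
proof -
  have "inj_on (head G) (out_arcs G v)"
    by (auto intro!: inj_onI no_multi_arcs simp: arc_to_ends_def)
  then have "degree G v = card (head G ` out_arcs G v)"
    by (simp add: degree_def out_degree_def card_image)
  also have "head G ` out_arcs G v = {u. v \<rightarrow>\<^bsub>G\<^esub> u}" by (auto simp: arcs_ends_conv)
  also have "card {u. v \<rightarrow>\<^bsub>G\<^esub> u} = edeg (edges G) v"
    unfolding edeg_def edges_at_eq
    by (rule card_image[symmetric]) (auto simp: inj_on_def doubleton_eq_iff)
  finally show ?thesis .
qed

text \<open>As \<open>v\<close> itself is heavy, an edge at \<open>v\<close> fails to be heavy
  exactly when its other end is light.\<close>

lemma card_light_neighbors:
  assumes "heavy G v"
  shows "card (light_neighbors G v) = edeg (edges G - heavy_edges G) v"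
proof -
  have "{e \<in> edges G - heavy_edges G. v \<in> e} = (\<lambda>u. {v, u}) ` light_neighbors G v"
  proof -
    have "{e \<in> edges G - heavy_edges G. v \<in> e} = {e \<in> {e \<in> edges G. v \<in> e}. e \<notin> heavy_edges G}"
      by auto
    also have "\<dots> = (\<lambda>u. {v, u}) ` light_neighbors G v"
      unfolding edges_at_eq using assms mem_edges_iff adj_in_verts
      by (auto simp: heavy_edges_def light_neighbors_def heavy_def light_def)
    finally show ?thesis .
  qed
  then show ?thesis
    unfolding edeg_def by (simp add: card_image inj_on_def doubleton_eq_iff)
qed

section \<open>From vertex sequences to arc walks and cycles\<close>

lemma vpath_iff: "vpath p G \<longleftrightarrow> p \<noteq> [] \<and> distinct p \<and> set p \<subseteq> verts G \<and> vedges p \<subseteq> edges G"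
  using mem_edges_iff by (auto simp: vpath_def vwalk_def vedges_def)

text \<open>Bridge to \<open>cycle\<close>, which speaks of lists of arcs: an arc is chosen for each
  pair of consecutive vertices.\<close>

lemma awalk_of_vwalk:
  "vwalk p G \<Longrightarrow> \<exists>q. awalk (hd p) q (last p) \<and> awalk_verts (hd p) q = p"
proof (induction rule: vwalk_induct)
  case (Base u)
  then show ?case by (intro exI[of _ "[]"]) (simp add: awalk_simps)
next
  case (Cons u v es)
  then obtain q where q: "awalk v q (last (v # es))" "awalk_verts v q = v # es" by auto
  obtain a where "a \<in> arcs G" "tail G a = u" "head G a = v" using Cons.hyps by blast
  then show ?case using q by (intro exI[of _ "a # q"]) (simp add: awalk_simps)
qed

text \<open>Repeating the first vertex at the end gives a closed walk. It has one arc fewer than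
  listed vertices, so the number of arcs is again the length of \<open>p\<close>.\<close>

lemma cycle_of_vedges:
  assumes "distinct p" "3 \<le> length p" "vedges p \<subseteq> edges G" "{last p, hd p} \<in> edges G"
  shows "\<exists>q. cycle q \<and> 3 \<le> length q"
proof -
  have ne: "p \<noteq> []" using assms(2) by auto
  let ?q = "p @ [hd p]"
  have "(last p, hd p) \<in> arcs_ends G" using assms(4) mem_edges_iff by blast
  moreover have "set (vwalk_arcs p) \<subseteq> arcs_ends G"
    using assms(3) mem_edges_iff by (auto simp: vedges_def)
  moreover have "set p \<subseteq> verts G"
  proof
    fix x assume "x \<in> set p"
    then obtain xs ys where p: "p = xs @ x # ys" by (auto simp: in_set_conv_decomp)
    have "\<exists>e\<in>edges G. x \<in> e"
    proof (cases "xs = []")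
      case True
      then show ?thesis using assms(4) p by auto
    next
      case False
      then show ?thesis using assms(3) p vedges_append[of xs "x # ys"] by auto
    qed
    then show "x \<in> verts G" using edges_card_2 by blast
  qed
  ultimately have "vwalk ?q G" using ne by (auto simp: vwalk_def vwalk_arcs_append)
  from awalk_of_vwalk[OF this] ne obtain q
    where q: "awalk (hd p) q (hd p)" "awalk_verts (hd p) q = ?q" by auto
  have "length (awalk_verts (hd p) q) = length q + 1" by (simp add: length_awalk_verts)
  then have "3 \<le> length q" using q(2) assms(2) by simp
  moreover have "distinct (tl ?q)" using assms(1) ne by (cases p) auto
  ultimately show ?thesis using q unfolding cycle_def by (intro exI[of _ q]) auto
qed

end

theorem theorem13:
  fixes T :: "('a, 'b) pre_digraph" and S :: "'a set" and l h s t :: nat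
  assumes tree: "undirected_tree T"
    and l: "l = card (leaves T)" and l_ge_2: "l \<ge> 2"
    and light_nbr: "\<And>v. heavy T v \<Longrightarrow> \<exists>u. u \<in> light_neighbors T v"
    and S: "S = {v. heavy T v \<and> card (light_neighbors T v) = 1}"
    and h: "h = card (heavy_edges T)"
    and s: "s = card S"
    and t: "t = maximum_matching_size (T \<restriction> S)"
  shows "int (path_covering_number T) = int l - int h + int s - int t - 1"
proof -
  interpret graph T using tree by (simp add: undirected_tree_def)
  let ?E = "edges T" and ?V = "verts T" and ?H = "heavy_edges T"
  define W where "W = {v. heavy T v}"
  have finW: "finite W" and WV: "W \<subseteq> ?V"
    by (auto simp: W_def heavy_def intro: finite_subset[of _ ?V])
  have acyclic: "edge_acyclic ?E"
    using tree cycle_of_vedges unfolding undirected_tree_def edge_acyclic_def by blast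
  have "strongly_connected T"
    using tree symmetric_connected_imp_strongly_connected sym_arcs by (auto simp: undirected_tree_def)
  then have conn: "?V \<times> ?V \<subseteq> (arcs_ends T)\<^sup>*" and "?V \<noteq> {}"
    by (auto simp: strongly_connected_def dest: reachable_rtranclI)
  moreover have adj: "{(x, y). {x, y} \<in> ?E} = arcs_ends T" using mem_edges_iff by auto
  ultimately have tree_card: "card ?E + 1 = card ?V"
    using card_edges_of_connected_acyclic[OF finite_edges finite_verts _ edges_card_2 acyclic]
    by simp

  have deg_pos: "0 < edeg ?E v" if v: "v \<in> ?V" for v
  proof -
    \<comment> \<open>Two leaves provide a vertex other than \<open>v\<close>; a walk from
      \<open>v\<close> to it begins with an edge at \<open>v\<close>.\<close>
    have "\<not> leaves T \<subseteq> {v}" using l l_ge_2 card_mono[of "{v}" "leaves T"] by auto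
    then obtain w where w: "w \<in> ?V" "w \<noteq> v" by (auto simp: leaves_def)
    then have "(v, w) \<in> (arcs_ends T)\<^sup>*" using conn v by blast
    then obtain u where "v \<rightarrow>\<^bsub>T\<^esub> u" using w(2) by (auto elim: converse_rtranclE)
    then have "{v, u} \<in> {e \<in> ?E. v \<in> e}" using mem_edges_iff by auto
    then show ?thesis unfolding edeg_def using finite_edges by (auto simp: card_gt_0_iff)
  qed
  have heavy_sum: "(\<Sum>v\<in>W. edeg ?E v - 2) + 2 = l"
  proof -
    have "(\<Sum>v\<in>?V. edeg ?E v) = 2 * card ?E"
      using finite_edges finite_verts edges_card_2 by (rule sum_edeg_of_edges_within)
    then have "(\<Sum>v\<in>?V. edeg ?E v) + 2 = (\<Sum>v\<in>?V. 2)" using tree_card by simp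
    \<comment> \<open>The identity holds vertex by vertex: a leaf is raised from 1 to 2, degree 2
      agrees, and a heavy vertex contributes its excess over 2. Degree 0 is excluded by
      \<open>deg_pos\<close>.\<close>
    moreover have "(\<Sum>v\<in>?V. edeg ?E v) + (\<Sum>v\<in>?V. if v \<in> leaves T then 1 else 0) =
        (\<Sum>v\<in>?V. 2) + (\<Sum>v\<in>?V. if v \<in> W then edeg ?E v - 2 else 0)"
      unfolding sum.distrib[symmetric]
    proof (rule sum.cong[OF refl])
      fix v assume "v \<in> ?V"
      then show "edeg ?E v + (if v \<in> leaves T then 1 else 0) =
          2 + (if v \<in> W then edeg ?E v - 2 else 0)"
        using deg_pos[of v] by (auto simp: leaves_def W_def heavy_def degree_eq_edeg)
    qed
    moreover have "(\<Sum>v\<in>?V. if v \<in> leaves T then 1 else 0) = l"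
      unfolding l by (simp add: sum.If_cases leaves_def Int_def)
    moreover have "(\<Sum>v\<in>?V. if v \<in> W then edeg ?E v - 2 else 0) = (\<Sum>v\<in>W. edeg ?E v - 2)"
      using WV by (simp add: sum.If_cases Int_absorb1)
    ultimately show ?thesis by linarith
  qed

  have HE: "?H \<subseteq> ?E" by (auto simp: heavy_edges_def)
  have light_count: "card (light_neighbors T v) + edeg ?H v = edeg ?E v" if "v \<in> W" for v
    using edeg_Diff[OF finite_edges HE, of v] card_light_neighbors[of v] that by (simp add: W_def)
  have light_pos: "0 < card (light_neighbors T v)" if "v \<in> W" for v
  proof -
    have "light_neighbors T v \<subseteq> ?V" by (auto simp: light_neighbors_def light_def)
    then show ?thesis using light_nbr[of v] that finite_subset[of _ ?V]
      by (auto simp: W_def card_gt_0_iff)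
  qed
  have edges_S: "edges (T \<restriction> S) = {e \<in> ?E. e \<subseteq> S}"
    by (auto simp: edges_def arcs_ends_conv)
  \<comment> \<open>\<open>Max\<close> in the definition of the matching size is meaningful only on
    a finite nonempty set; the empty matching is a member.\<close>
  have matchings: "finite {M. matching (T \<restriction> S) M}" "matching (T \<restriction> S) {}"
    using finite_edges by (auto simp: matching_def edges_S intro: finite_subset[of _ "Pow ?E"])
  interpret heavy_edge_structure ?E W ?H S t
  proof
    show "finite ?E" "finite W" by (rule finite_edges, rule finW)
    show "card e = 2" if "e \<in> ?E" for e using edges_card_2[OF that] by simp
    show "2 < edeg ?E v" if "v \<in> W" for v using that by (simp add: W_def heavy_def degree_eq_edeg)
    show "S \<subseteq> W" by (auto simp: S W_def)
    show "?H = {e \<in> ?E. e \<subseteq> W}" by (auto simp: heavy_edges_def W_def)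
    show "edeg ?H v + 1 = edeg ?E v" if "v \<in> S" for v
      using light_count[of v] that by (auto simp: S W_def)
    \<comment> \<open>Outside \<open>S\<close> the number of light neighbors is positive and
      different from 1, hence at least 2.\<close>
    show "edeg ?H v + 2 \<le> edeg ?E v" if "v \<in> W - S" for v
      using light_count[of v] light_pos[of v] that by (auto simp: S W_def)
    show "card M \<le> t" if "M \<subseteq> ?E" "\<forall>e\<in>M. e \<subseteq> S" "\<forall>e\<in>M. \<forall>f\<in>M. e \<noteq> f \<longrightarrow> e \<inter> f = {}" for M
    proof -
      have "matching (T \<restriction> S) M" using that by (auto simp: matching_def edges_S)
      then show ?thesis unfolding t maximum_matching_size_def using matchings by (intro Max_ge) auto
    qed
    have "t \<in> card ` {M. matching (T \<restriction> S) M}"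
      unfolding t maximum_matching_size_def using matchings by (intro Max_in) auto
    then obtain M where M: "matching (T \<restriction> S) M" "card M = t" by blast
    then have "M \<subseteq> ?E" "\<forall>e\<in>M. e \<subseteq> S" "\<forall>e\<in>M. \<forall>f\<in>M. e \<noteq> f \<longrightarrow> e \<inter> f = {}"
      unfolding matching_def edges_S by blast+
    with M(2) show "\<exists>M\<subseteq>?E. (\<forall>e\<in>M. e \<subseteq> S) \<and>
        (\<forall>e\<in>M. \<forall>f\<in>M. e \<noteq> f \<longrightarrow> e \<inter> f = {}) \<and> card M = t"
      by (intro exI[of _ M] conjI)
  qed

  have lower: "l + s \<le> card C + h + t + 1" if C: "path_covering T C" for C
  proof -
    let ?F = "\<Union>p\<in>C. vedges p"
    have C': "finite C" "\<forall>p\<in>C. vpath p T"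
      "\<forall>p\<in>C. \<forall>q\<in>C. p \<noteq> q \<longrightarrow> set p \<inter> set q = {}" "(\<Union>p\<in>C. set p) = ?V"
      using C unfolding path_covering_def by simp_all
    have FE: "?F \<subseteq> ?E" using C'(2) vpath_iff by blast
    have "\<And>p. p \<in> C \<Longrightarrow> p \<noteq> [] \<and> distinct p" using C'(2) vpath_iff by blast
    moreover have "\<And>p q. p \<in> C \<Longrightarrow> q \<in> C \<Longrightarrow> p \<noteq> q \<Longrightarrow> set p \<inter> set q = {}"
      using C'(3) by blast
    ultimately have F: "card ?F + card C = card (\<Union>p\<in>C. set p)" "edeg ?F v \<le> 2" for v
      using edge_set_of_disjoint_paths[OF C'(1)] by simp_all
    have "edeg ?E v \<le> edeg (?E - ?F) v + 2" for v
      using edeg_Diff[OF finite_edges FE, of v] F(2)[of v] by linarith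
    then have "(\<Sum>v\<in>W. edeg ?E v - 2) + card S \<le> card (?E - ?F) + card ?H + t"
      by (intro removed_edges_lower_bound) auto
    moreover have "card (?E - ?F) + card ?F = card ?E"
      using FE finite_edges by (metis card_Diff_subset card_mono finite_subset le_add_diff_inverse2)
    ultimately show ?thesis using F(1) C'(4) tree_card heavy_sum h s by simp
  qed
  \<comment> \<open>Deleting the optimal \<open>R\<close> leaves a forest of maximum degree two,
    whose paths number \<open>card R + 1\<close>.\<close>
  have upper: "\<exists>C. path_covering T C \<and> card C + h + t + 1 \<le> l + s"
  proof -
    obtain R where R: "R \<subseteq> ?E" "\<And>v. v \<in> W \<Longrightarrow> edeg ?E v \<le> edeg R v + 2"
      "card R + card ?H + t \<le> (\<Sum>v\<in>W. edeg ?E v - 2) + card S"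
      using removed_edges_upper_bound by blast
    let ?F = "?E - R"
    have "edeg ?F v \<le> 2" for v
    proof (cases "v \<in> W")
      case True
      then show ?thesis using R(2) edeg_Diff[OF finite_edges R(1), of v] by fastforce
    next
      case False
      \<comment> \<open>The degree bound is required for all elements of the type; those that are
        not vertices lie on no edge.\<close>
      have "edeg ?E v = 0" if "v \<notin> ?V"
        using that edges_card_2 by (intro edeg_eq_0) blast
      then have "edeg ?E v \<le> 2" using False by (auto simp: W_def heavy_def degree_eq_edeg)
      then show ?thesis using edeg_Diff[OF finite_edges R(1), of v] by linarith
    qed
    moreover have "finite ?F" "edge_acyclic ?F"
      using finite_edges edge_acyclic_subset[OF acyclic] by simp_all
    moreover have "card e = 2 \<and> e \<subseteq> ?V" if "e \<in> ?F" for e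
      using edges_card_2[of e] that by simp
    ultimately obtain C where C: "finite C" "\<forall>p\<in>C. p \<noteq> [] \<and> distinct p"
      "\<forall>p\<in>C. \<forall>q\<in>C. p \<noteq> q \<longrightarrow> set p \<inter> set q = {}"
      "(\<Union>p\<in>C. set p) = ?V" "(\<Union>p\<in>C. vedges p) = ?F" "card C + card ?F = card ?V"
      using disjoint_paths_of_edge_set[of ?F ?V] finite_verts by metis
    have "vpath p T" if "p \<in> C" for p
    proof -
      have "vedges p \<subseteq> ?E" using C(5) that by blast
      moreover have "set p \<subseteq> ?V" using C(4) that by blast
      ultimately show ?thesis using C(2) that unfolding vpath_iff by simp
    qed
    then have "path_covering T C" using C(1,3,4) unfolding path_covering_def by simp
    moreover have "card ?F + card R = card ?E"
      using R(1) finite_edges by (metis card_Diff_subset card_mono finite_subset le_add_diff_inverse2)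
    then have "card C + h + t + 1 \<le> l + s" using C(6) tree_card R(3) heavy_sum h s by linarith
    ultimately show ?thesis by blast
  qed
  obtain C where C: "path_covering T C" "card C + h + t + 1 \<le> l + s" using upper by blast
  then have eq: "card C + h + t + 1 = l + s" using lower[OF C(1)] by linarith
  have "path_covering_number T = card C"
    unfolding path_covering_number_def
  proof (rule Least_equality)
    show "\<exists>D. path_covering T D \<and> card D = card C" using C(1) by blast
    fix k assume "\<exists>D. path_covering T D \<and> card D = k"
    then obtain D where "path_covering T D" "card D = k" by blast
    then show "card C \<le> k" using lower[of D] eq by linarith
  qed
  then show ?thesis using eq by linarith
qed

end
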